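(* Fix $n$, a probability measure $\pi$ on $[0,1]$, and a continuous connection function $p:\mathbb{R}_{\ge 0}\to[0,1]$. For each dimension $d$ let $\mathcal{G}_d$ be the ensemble of $n$-node soft random geometric graphs in $\mathbb{T}^d$ with connection function $p(r/r_0)$ and with i.i.d. nodes whose $d$ coordinates are i.i.d. with law $\pi$. If $r_0=r_0(d)=\sqrt{kd}+o(\sqrt d)$ as $d\to\infty$ for some constant $k>0$, then $\mathcal{G}_d\to G(n,p_k)$ in distribution as $d\to\infty$, where $p_k:=p\left(\sqrt{\mu_T/k}\right)$.
   Context: $\mathbb{T}^d=(\mathbb{R}/\mathbb{Z})^d$ is the unit torus, with points represented by coordinates in $[0,1]$ and metric $\rho_T(x,y)=\sqrt{\sum_{i=1}^d\min(|x_i-y_i|,1-|x_i-y_i|)^2}$; for $d=1$ the same symbol denotes the metric on $\mathbb{T}^1$. A connection function is a non-increasing function $p:\mathbb{R}_{\ge0}\to[0,1]$. A soft random geometric graph on a metric space $(\Omega,\rho)$ with connection function $p(r/r_0)$ has vertex set $\{1,\dots,n\}$ and random i.i.d. positions $X_1,\dots,X_n\in\Omega$; given the positions, each edge $(i,j)$ is included independently with probability $p(\rho(X_i,X_j)/r_0)$. The ensemble is the resulting probability distribution on labelled graphs on $\{1,\dots,n\}$. $\mu_T=\mathbb{E}[\rho_T(X,Y)^2]$, where $X,Y$ are independent with law $\pi$ on $\mathbb{T}^1$. $G(n,p)$ is the Erdős–Rényi ensemble on $n$ labelled nodes (each edge present independently with probability $p$). A sequence of graph ensembles on $n$ labelled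 nodes with probability measures $\mathbb{P}_d$ converges in distribution to an ensemble with measure $\mathbb{P}$ if $\mathbb{P}_d(g)\to\mathbb{P}(g)$ for every labelled graph $g$ on $n$ nodes. *)

theory Defs
  imports "HOL-Probability.Probability" "HOL-Library.Landau_Symbols"
begin

definition circle_dist :: "real \<Rightarrow> real \<Rightarrow> real" where
  "circle_dist x y = min \<bar>x - y\<bar> (1 - \<bar>x - y\<bar>)"

(* The coordinates of a point are indexed by 1..d and lie in [0,1]. The endpoints 0 and 1 are
   not identified, but their distance is 0. *)
definition torus_dist :: "nat \<Rightarrow> (nat \<Rightarrow> real) \<Rightarrow> (nat \<Rightarrow> real) \<Rightarrow> real" where
  "torus_dist d x y = sqrt (\<Sum>i=1..d. (circle_dist (x i) (y i))\<^sup>2)"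

lemma torus_dist_1:
  assumes "x 1 \<in> {0..1}" "y 1 \<in> {0..1}"
  shows "torus_dist 1 x y = circle_dist (x 1) (y 1)"
  using assms by (auto simp: torus_dist_def circle_dist_def abs_if)

definition mean_sq_circle_dist :: "real measure \<Rightarrow> real" where
  "mean_sq_circle_dist \<pi> = (\<integral>(x, y). (circle_dist x y)\<^sup>2 \<partial>(\<pi> \<Otimes>\<^sub>M \<pi>))"

(* Only the values on the nonnegative reals are constrained. *)
definition connection_function :: "(real \<Rightarrow> real) \<Rightarrow> bool" where
  "connection_function p \<longleftrightarrow> antimono_on {0..} p \<and> p ` {0..} \<subseteq> {0..1}"

(* A simple graph on the nodes 1..n is its set of edges, where the edge joining i and j
   is the pair (i, j) with i < j. *)
definition node_pairs :: "nat \<Rightarrow> (nat \<times> nat) set" where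
  "node_pairs n = {(i, j). 1 \<le> i \<and> i < j \<and> j \<le> n}"

definition labelled_graphs :: "nat \<Rightarrow> (nat \<times> nat) set set" where
  "labelled_graphs n = Pow (node_pairs n)"

(* Each edge (i, j) is present independently with probability q i j. *)
definition independent_edges :: "nat \<Rightarrow> (nat \<Rightarrow> nat \<Rightarrow> real) \<Rightarrow> (nat \<times> nat) set pmf" where
  "independent_edges n q =
     map_pmf (\<lambda>b. {e \<in> node_pairs n. b e})
       (Pi_pmf (node_pairs n) False (\<lambda>(i, j). bernoulli_pmf (q i j)))"

definition erdos_renyi :: "nat \<Rightarrow> real \<Rightarrow> (nat \<times> nat) set measure" where
  "erdos_renyi n q = measure_pmf (independent_edges n (\<lambda>i j. q))"

(* The nodes have independent positions with law M in a space with metric \<rho>; the bind of the Giry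
   monad averages the conditional law of the edges, given the positions, over the positions. *)
definition soft_rgg ::
  "nat \<Rightarrow> 'a measure \<Rightarrow> ('a \<Rightarrow> 'a \<Rightarrow> real) \<Rightarrow> (real \<Rightarrow> real) \<Rightarrow> real \<Rightarrow> (nat \<times> nat) set measure" where
  "soft_rgg n M \<rho> p r0 =
     (\<Pi>\<^sub>M i\<in>{1..n}. M) \<bind>
       (\<lambda>X. measure_pmf (independent_edges n (\<lambda>i j. p (\<rho> (X i) (X j) / r0))))"

definition torus_soft_rgg ::
  "nat \<Rightarrow> real measure \<Rightarrow> (real \<Rightarrow> real) \<Rightarrow> nat \<Rightarrow> real \<Rightarrow> (nat \<times> nat) set measure" where
  "torus_soft_rgg n \<pi> p d r0 = soft_rgg n (\<Pi>\<^sub>M i\<in>{1..d}. \<pi>) (torus_dist d) p r0"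

definition ensembles_converge ::
  "nat \<Rightarrow> (nat \<Rightarrow> (nat \<times> nat) set measure) \<Rightarrow> (nat \<times> nat) set measure \<Rightarrow> bool" where
  "ensembles_converge n P Q \<longleftrightarrow>
     (\<forall>g\<in>labelled_graphs n. (\<lambda>d. measure (P d) {g}) \<longlonglongrightarrow> measure Q {g})"

end

(* The average over d coordinates of the squared circle distances of two nodes has mean mu_T and
   variance at most 1/d, so the distance of the two nodes divided by r0 tends to sqrt (mu_T / k)
   in probability. Since p is bounded and continuous, each edge probability tends to p_k in L^1
   with respect to the positions. The probability of a fixed graph given the positions is a product
   of factors in [0,1], so it differs from its Erdos-Renyi value by at most the sum of the
   deviations of the edge probabilities. Dependence between different edges therefore plays
   no role. *)

theory Submission
  imports Defs
begin

section \<open>Random graphs with independent edges\<close>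

lemma finite_node_pairs: "finite (node_pairs n)"
  by (rule finite_subset[of _ "{1..n} \<times> {1..n}"]) (auto simp: node_pairs_def)

lemma pmf_independent_edges:
  assumes g: "g \<in> labelled_graphs n"
    and q: "\<And>i j. (i, j) \<in> node_pairs n \<Longrightarrow> q i j \<in> {0..1}"
  shows "pmf (independent_edges n q) g =
    (\<Prod>(i, j)\<in>node_pairs n. if (i, j) \<in> g then q i j else 1 - q i j)"
proof -
  let ?P = "Pi_pmf (node_pairs n) False (\<lambda>(i, j). bernoulli_pmf (q i j))"
  have "pmf (independent_edges n q) g =
      measure ?P ((\<lambda>b. {e \<in> node_pairs n. b e}) -` {g})"
    by (simp add: independent_edges_def pmf_map)
  \<comment> \<open>The preimage of \<open>g\<close> contains every \<open>b\<close> with the right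
    values on the node pairs, whatever its values elsewhere. Since the default value of
    \<open>Pi_pmf\<close> is \<open>False\<close>, all of these except the indicator of
    \<open>g\<close> have mass zero.\<close>
  also have "\<dots> = measure ?P {\<lambda>e. e \<in> g}"
  proof (rule measure_prob_cong_0)
    fix b assume b: "b \<in> (\<lambda>b. {e \<in> node_pairs n. b e}) -` {g} - {\<lambda>e. e \<in> g}"
    then have "\<exists>e. e \<notin> node_pairs n \<and> b e \<noteq> False"
      by (auto simp: fun_eq_iff)
    then show "pmf ?P b = 0"
      by (intro pmf_Pi_outside finite_node_pairs) auto
  next
    fix b assume "b \<in> {\<lambda>e. e \<in> g} - (\<lambda>b. {e \<in> node_pairs n. b e}) -` {g}"
    then show "pmf ?P b = 0"
      using g by (auto simp: labelled_graphs_def)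
  qed
  also have "\<dots> = pmf ?P (\<lambda>e. e \<in> g)"
    by (simp add: pmf.rep_eq)
  also have "\<dots> = (\<Prod>e\<in>node_pairs n. pmf (case e of (i, j) \<Rightarrow> bernoulli_pmf (q i j)) (e \<in> g))"
    using g by (intro pmf_Pi' finite_node_pairs) (auto simp: labelled_graphs_def)
  also have "\<dots> = (\<Prod>(i, j)\<in>node_pairs n. if (i, j) \<in> g then q i j else 1 - q i j)"
    using q by (intro prod.cong refl) (auto split: prod.splits)
  finally show ?thesis .
qed

lemma set_pmf_independent_edges: "set_pmf (independent_edges n q) \<subseteq> labelled_graphs n"
  by (auto simp: independent_edges_def labelled_graphs_def)

text \<open>If all factors have absolute value at most 1, exchanging one of them changes the product
  by at most the change of that factor; exchanging them one at a time gives the sum. Present and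
  absent edges contribute alike, as \<open>q\<close> and \<open>1 - q\<close> change by the same
  amount.\<close>

lemma abs_pmf_independent_edges_diff:
  assumes g: "g \<in> labelled_graphs n"
    and q: "\<And>i j. (i, j) \<in> node_pairs n \<Longrightarrow> q i j \<in> {0..1}"
    and q': "\<And>i j. (i, j) \<in> node_pairs n \<Longrightarrow> q' i j \<in> {0..1}"
  shows "\<bar>pmf (independent_edges n q) g - pmf (independent_edges n q') g\<bar> \<le>
    (\<Sum>(i, j)\<in>node_pairs n. \<bar>q i j - q' i j\<bar>)"
proof -
  let ?w = "\<lambda>q (i, j). if (i, j) \<in> g then q i j else 1 - q i j :: real"
  have "norm (prod (?w q) (node_pairs n) - prod (?w q') (node_pairs n)) \<le>
      (\<Sum>e\<in>node_pairs n. norm (?w q e - ?w q' e))"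
    by (rule norm_prod_diff) (use q q' in \<open>auto split: prod.splits\<close>)
  also have "\<dots> = (\<Sum>(i, j)\<in>node_pairs n. \<bar>q i j - q' i j\<bar>)"
    by (intro sum.cong) (auto split: prod.splits)
  finally show ?thesis
    using pmf_independent_edges[OF g q] pmf_independent_edges[OF g q'] by simp
qed

text \<open>This makes the edge law a measurable kernel, so that the bind in \<open>soft_rgg\<close>
  can be evaluated. The set \<open>A\<close> is arbitrary, but only its finitely many members in
  \<open>labelled_graphs n\<close> carry mass, so its mass is a polynomial in the edge
  probabilities.\<close>

lemma measurable_independent_edges:
  assumes m: "\<And>i j. (i, j) \<in> node_pairs n \<Longrightarrow> (\<lambda>X. q X i j) \<in> borel_measurable N"
    and q: "\<And>X i j. X \<in> space N \<Longrightarrow> (i, j) \<in> node_pairs n \<Longrightarrow> q X i j \<in> {0..1}"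
  shows "(\<lambda>X. measure_pmf (independent_edges n (q X))) \<in> measurable N (subprob_algebra (count_space UNIV))"
proof (rule measurable_subprob_algebra)
  fix A :: "(nat \<times> nat) set set"
  have fin: "finite (labelled_graphs n)"
    by (simp add: labelled_graphs_def finite_node_pairs)
  have "emeasure (measure_pmf (independent_edges n (q X))) A =
      ennreal (\<Sum>g\<in>A \<inter> labelled_graphs n. \<Prod>(i, j)\<in>node_pairs n. if (i, j) \<in> g then q X i j else 1 - q X i j)"
    if X: "X \<in> space N" for X
  proof -
    have "measure (measure_pmf (independent_edges n (q X))) A =
        measure (measure_pmf (independent_edges n (q X))) (A \<inter> labelled_graphs n)"
      using set_pmf_independent_edges[of n "q X"]
      by (intro measure_prob_cong_0) (auto simp: set_pmf_iff)
    also have "\<dots> = (\<Sum>g\<in>A \<inter> labelled_graphs n. pmf (independent_edges n (q X)) g)"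
      using fin by (simp add: measure_measure_pmf_finite)
    also have "\<dots> = (\<Sum>g\<in>A \<inter> labelled_graphs n. \<Prod>(i, j)\<in>node_pairs n. if (i, j) \<in> g then q X i j else 1 - q X i j)"
      using q[OF X] by (intro sum.cong refl pmf_independent_edges) auto
    finally show ?thesis
      by (simp add: measure_pmf.emeasure_eq_measure)
  qed
  moreover have "(\<lambda>X. ennreal (\<Sum>g\<in>A \<inter> labelled_graphs n. \<Prod>(i, j)\<in>node_pairs n.
      if (i, j) \<in> g then q X i j else 1 - q X i j)) \<in> borel_measurable N"
  proof (intro measurable_compose[OF _ measurable_ennreal] borel_measurable_sum borel_measurable_prod)
    fix g e assume "e \<in> node_pairs n"
    then show "(\<lambda>X. case e of (i, j) \<Rightarrow> if (i, j) \<in> g then q X i j else 1 - q X i j) \<in> borel_measurable N"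
      using m by (cases e) auto
  qed
  ultimately show "(\<lambda>X. emeasure (measure_pmf (independent_edges n (q X))) A) \<in> borel_measurable N"
    by (simp cong: measurable_cong)
qed (auto simp: measure_pmf.subprob_space_axioms)

section \<open>Joint laws and second moments in product spaces\<close>

text \<open>A rectangle pulls back to a cylinder over the two coordinates, whose mass is the product
  of the masses of its sides, and rectangles determine the product measure. With nodes as
  coordinates, this reduces the expectation for one edge to an integral over two positions.\<close>

lemma distr_PiM_pair:
  assumes M: "\<And>i. prob_space (M i)" and ij: "i \<in> I" "j \<in> I" "i \<noteq> j"
  shows "distr (PiM I M) (M i \<Otimes>\<^sub>M M j) (\<lambda>x. (x i, x j)) = M i \<Otimes>\<^sub>M M j"
proof -
  interpret product_prob_space M I
    by (intro product_prob_spaceI M)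
  interpret P: pair_prob_space "M i" "M j" ..
  have [measurable]: "(\<lambda>x. x i) \<in> measurable (PiM I M) (M i)" "(\<lambda>x. x j) \<in> measurable (PiM I M) (M j)"
    using ij by (auto intro: measurable_component_singleton)
  show ?thesis
  proof (rule pair_measure_eqI[symmetric])
    fix A B assume AB: "A \<in> sets (M i)" "B \<in> sets (M j)"
    let ?X = "\<lambda>k. if k = i then A else B"
    have "emeasure (distr (PiM I M) (M i \<Otimes>\<^sub>M M j) (\<lambda>x. (x i, x j))) (A \<times> B) =
        emeasure (PiM I M) ((\<lambda>x. (x i, x j)) -` (A \<times> B) \<inter> space (PiM I M))"
      using AB by (intro emeasure_distr) auto
    also have "(\<lambda>x. (x i, x j)) -` (A \<times> B) \<inter> space (PiM I M) = prod_emb I M {i, j} (Pi\<^sub>E {i, j} ?X)"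
      using ij by (auto simp: prod_emb_def space_PiM PiE_iff)
    also have "emeasure (PiM I M) \<dots> = (\<Prod>k\<in>{i, j}. emeasure (M k) (?X k))"
      using ij AB by (intro emeasure_PiM_emb) auto
    finally show "emeasure (M i) A * emeasure (M j) B =
        emeasure (distr (PiM I M) (M i \<Otimes>\<^sub>M M j) (\<lambda>x. (x i, x j))) (A \<times> B)"
      using ij by simp
  qed (auto intro: M prob_space_imp_sigma_finite)
qed

lemma integral_PiM_mult:
  fixes u v :: "'a \<Rightarrow> real"
  assumes "prob_space M" "finite I" and ij: "i \<in> I" "j \<in> I" "i \<noteq> j"
    and "integrable M u" "integrable M v"
  shows "(\<integral>x. u (x i) * v (x j) \<partial>PiM I (\<lambda>_. M)) = (\<integral>a. u a \<partial>M) * (\<integral>a. v a \<partial>M)"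
proof -
  interpret prob_space M by fact
  interpret product_sigma_finite "\<lambda>_. M"
    by standard
  \<comment> \<open>Padding with the constant 1, which has integral 1, turns two factors into a
    product over all of \<open>I\<close>, to which Fubini for finite products applies. The fact
    \<open>prod\<close> then removes the padding both in the integrand and in the product of
    integrals.\<close>
  define f where "f k = (if k = i then u else if k = j then v else (\<lambda>_. 1))" for k
  have prod: "(\<Prod>k\<in>I. h k) = h i * h j" if "\<And>k. k \<in> I - {i, j} \<Longrightarrow> h k = 1" for h :: "_ \<Rightarrow> real"
  proof -
    have "(\<Prod>k\<in>I. h k) = (\<Prod>k\<in>{i, j}. h k)"
      using \<open>finite I\<close> ij that by (intro prod.mono_neutral_right) auto
    then show ?thesis using ij by simp
  qed
  have "(\<integral>x. (\<Prod>k\<in>I. f k (x k)) \<partial>PiM I (\<lambda>_. M)) = (\<Prod>k\<in>I. \<integral>a. f k a \<partial>M)"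
    using assms by (intro product_integral_prod) (auto simp: f_def)
  then show ?thesis
    using ij by (subst (asm) (1 2) prod) (auto simp: f_def prob_space)
qed

text \<open>For independent points \<open>x\<close> and \<open>y\<close> the coordinate pairs
  \<open>(x c, y c)\<close> and \<open>(x c', y c')\<close> are independent. The proof integrates
  over \<open>y\<close> and then over \<open>x\<close>, splitting the product each time because the
  two factors see different coordinates.\<close>

lemma integral_PiM_pair_mult:
  fixes f g :: "'a \<times> 'a \<Rightarrow> real"
  assumes M: "prob_space M" and I: "finite I" "c \<in> I" "c' \<in> I" "c \<noteq> c'"
    and [measurable]: "f \<in> borel_measurable (M \<Otimes>\<^sub>M M)" "g \<in> borel_measurable (M \<Otimes>\<^sub>M M)"
    and f: "\<And>z. z \<in> space (M \<Otimes>\<^sub>M M) \<Longrightarrow> \<bar>f z\<bar> \<le> 1"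
    and g: "\<And>z. z \<in> space (M \<Otimes>\<^sub>M M) \<Longrightarrow> \<bar>g z\<bar> \<le> 1"
  shows "(\<integral>(x, y). f (x c, y c) * g (x c', y c') \<partial>(PiM I (\<lambda>_. M) \<Otimes>\<^sub>M PiM I (\<lambda>_. M))) =
    (\<integral>z. f z \<partial>(M \<Otimes>\<^sub>M M)) * (\<integral>z. g z \<partial>(M \<Otimes>\<^sub>M M))"
proof -
  let ?P = "PiM I (\<lambda>_. M)"
  interpret M: prob_space M by fact
  interpret P: prob_space ?P by (intro prob_space_PiM M)
  interpret MM: pair_prob_space M M ..
  interpret PP: pair_prob_space ?P ?P ..
  have comp: "x k \<in> space M" if "x \<in> space ?P" "k \<in> I" for x k
    using that by (auto simp: space_PiM)
  have [measurable]: "(\<lambda>x. x c) \<in> measurable ?P M" "(\<lambda>x. x c') \<in> measurable ?P M"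
    using I by (auto intro: measurable_component_singleton)
  have int: "integrable (M \<Otimes>\<^sub>M M) f" "integrable (M \<Otimes>\<^sub>M M) g"
    using f g by (auto intro!: MM.integrable_const_bound[where B = 1])
  \<comment> \<open>The integrals are rewritten below at each single point \<open>x\<close>, so
    every section has to be integrable, not just almost every one; the bound on \<open>h\<close>
    provides this.\<close>
  have sect: "integrable M (\<lambda>b. h (a, b))"
    if "a \<in> space M" "h \<in> borel_measurable (M \<Otimes>\<^sub>M M)" "\<And>z. z \<in> space (M \<Otimes>\<^sub>M M) \<Longrightarrow> \<bar>h z\<bar> \<le> 1"
    for a and h :: "'a \<times> 'a \<Rightarrow> real"
    using that by (intro M.integrable_const_bound[where B = 1]) (auto simp: space_pair_measure)
  have "(\<integral>(x, y). f (x c, y c) * g (x c', y c') \<partial>(?P \<Otimes>\<^sub>M ?P)) =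
      (\<integral>x. \<integral>y. f (x c, y c) * g (x c', y c') \<partial>?P \<partial>?P)"
  proof (subst PP.integral_fst'[symmetric])
    have "\<bar>f (x c, y c) * g (x c', y c')\<bar> \<le> 1 * 1" if "x \<in> space ?P" "y \<in> space ?P" for x y
      unfolding abs_mult using that I comp by (intro mult_mono f g) (auto simp: space_pair_measure)
    then show "integrable (?P \<Otimes>\<^sub>M ?P) (\<lambda>(x, y). f (x c, y c) * g (x c', y c'))"
      by (intro PP.integrable_const_bound[where B = 1]) (auto simp: space_pair_measure)
  qed simp
  also have "\<dots> = (\<integral>x. (\<integral>b. f (x c, b) \<partial>M) * (\<integral>b. g (x c', b) \<partial>M) \<partial>?P)"
    using I comp f g by (intro Bochner_Integration.integral_cong refl integral_PiM_mult M sect) auto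
  also have "\<dots> = (\<integral>a. \<integral>b. f (a, b) \<partial>M \<partial>M) * (\<integral>a. \<integral>b. g (a, b) \<partial>M \<partial>M)"
    using I int by (intro integral_PiM_mult M MM.integrable_fst'[of f] MM.integrable_fst'[of g])
  also have "\<dots> = (\<integral>z. f z \<partial>(M \<Otimes>\<^sub>M M)) * (\<integral>z. g z \<partial>(M \<Otimes>\<^sub>M M))"
    using int by (simp add: MM.integral_fst')
  finally show ?thesis .
qed

text \<open>A quantitative weak law of large numbers: the centred summands are pairwise orthogonal
  and bounded by 1, so the second moment of their sum is at most \<open>card I\<close>, and
  averaging divides it by the square of \<open>card I\<close>.\<close>

lemma second_moment_average_PiM_pair:
  fixes h :: "'a \<times> 'a \<Rightarrow> real" and I :: "'i set"
  assumes M: "prob_space M" and I: "finite I" "I \<noteq> {}"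
    and h[measurable]: "h \<in> borel_measurable (M \<Otimes>\<^sub>M M)"
    and h01: "\<And>z. z \<in> space (M \<Otimes>\<^sub>M M) \<Longrightarrow> h z \<in> {0..1}"
  defines "\<mu> \<equiv> \<integral>z. h z \<partial>(M \<Otimes>\<^sub>M M)"
  defines "Q \<equiv> PiM I (\<lambda>_. M) \<Otimes>\<^sub>M PiM I (\<lambda>_. M)"
  shows "integrable Q (\<lambda>(x, y). ((\<Sum>c\<in>I. h (x c, y c)) / card I - \<mu>)\<^sup>2)"
    and "(\<integral>(x, y). ((\<Sum>c\<in>I. h (x c, y c)) / card I - \<mu>)\<^sup>2 \<partial>Q) \<le> 1 / card I"
proof -
  let ?P = "PiM I (\<lambda>_. M)"
  interpret M: prob_space M by fact
  interpret P: prob_space ?P by (intro prob_space_PiM M)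
  interpret MM: pair_prob_space M M ..
  interpret PP: pair_prob_space ?P ?P ..
  interpret Q: prob_space Q unfolding Q_def by unfold_locales
  define Z where "Z c = (\<lambda>(x, y). h (x c, y c) - \<mu>)" for c :: 'i
  have int: "integrable (M \<Otimes>\<^sub>M M) h"
    using h01 by (intro MM.integrable_const_bound[where B = 1]) auto
  have mu: "\<mu> \<in> {0..1}"
  proof -
    have "\<mu> \<le> (\<integral>z. 1 \<partial>(M \<Otimes>\<^sub>M M))"
      unfolding \<mu>_def using h01 int by (intro integral_mono) auto
    moreover have "0 \<le> \<mu>"
      unfolding \<mu>_def using h01 by (intro Bochner_Integration.integral_nonneg) auto
    ultimately show ?thesis by (simp add: MM.prob_space)
  qed
  have centred: "\<bar>h z - \<mu>\<bar> \<le> 1" if "z \<in> space (M \<Otimes>\<^sub>M M)" for z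
    using h01[OF that] mu by auto
  have Z_bound: "\<bar>Z c z\<bar> \<le> 1" if "z \<in> space Q" "c \<in> I" for c z
    using that centred unfolding Q_def Z_def
    by (auto simp: space_pair_measure space_PiM PiE_iff)
  have Z_meas[measurable]: "Z c \<in> borel_measurable Q" if "c \<in> I" for c
  proof -
    have [measurable]: "(\<lambda>x. x c) \<in> measurable ?P M"
      using that by (auto intro: measurable_component_singleton)
    show ?thesis unfolding Z_def Q_def by measurable
  qed
  have ZZ_bound: "\<bar>Z c z * Z c' z\<bar> \<le> 1" if "z \<in> space Q" "c \<in> I" "c' \<in> I" for c c' z
    using mult_mono[OF Z_bound Z_bound, of z c z c'] that by (simp add: abs_mult)
  have ZZ_int: "integrable Q (\<lambda>z. Z c z * Z c' z)" if "c \<in> I" "c' \<in> I" for c c'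
    using that ZZ_bound by (intro Q.integrable_const_bound[where B = 1]) auto
  \<comment> \<open>Independence of different coordinates factors the integral, and both factors
    vanish because \<open>\<mu>\<close> is the mean of \<open>h\<close>.\<close>
  have orth: "(\<integral>z. Z c z * Z c' z \<partial>Q) = 0" if "c \<in> I" "c' \<in> I" "c \<noteq> c'" for c c'
  proof -
    have "(\<integral>z. Z c z * Z c' z \<partial>Q) =
        (\<integral>z. h z - \<mu> \<partial>(M \<Otimes>\<^sub>M M)) * (\<integral>z. h z - \<mu> \<partial>(M \<Otimes>\<^sub>M M))"
      using integral_PiM_pair_mult[OF M I(1) that, of "\<lambda>z. h z - \<mu>" "\<lambda>z. h z - \<mu>"] centred
      by (simp add: Z_def Q_def case_prod_unfold)
    then show ?thesis
      using int by (simp add: \<mu>_def[symmetric] MM.prob_space)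
  qed
  have diag: "(\<integral>z. Z c z * Z c z \<partial>Q) \<le> 1" if "c \<in> I" for c
  proof -
    have "(\<integral>z. Z c z * Z c z \<partial>Q) \<le> (\<integral>z. 1 \<partial>Q)"
      using ZZ_bound that by (intro integral_mono ZZ_int) (auto simp: abs_le_iff)
    then show ?thesis by (simp add: Q.prob_space)
  qed
  have expand: "(case z of (x, y) \<Rightarrow> ((\<Sum>c\<in>I. h (x c, y c)) / card I - \<mu>)\<^sup>2) =
      (\<Sum>c\<in>I. \<Sum>c'\<in>I. Z c z * Z c' z) / (card I)\<^sup>2" for z
  proof -
    have "(case z of (x, y) \<Rightarrow> ((\<Sum>c\<in>I. h (x c, y c)) / card I - \<mu>)\<^sup>2) = ((\<Sum>c\<in>I. Z c z) / card I)\<^sup>2"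
      using I by (cases z) (simp add: Z_def sum_subtractf field_simps)
    then show ?thesis
      by (simp add: power_divide power2_eq_square sum_product)
  qed
  show "integrable Q (\<lambda>(x, y). ((\<Sum>c\<in>I. h (x c, y c)) / card I - \<mu>)\<^sup>2)"
    unfolding expand
    by (intro Bochner_Integration.integrable_divide_zero Bochner_Integration.integrable_sum ZZ_int)
  have "(\<integral>(x, y). ((\<Sum>c\<in>I. h (x c, y c)) / card I - \<mu>)\<^sup>2 \<partial>Q) =
      (\<Sum>c\<in>I. \<Sum>c'\<in>I. \<integral>z. Z c z * Z c' z \<partial>Q) / (card I)\<^sup>2"
    unfolding expand by (simp add: Bochner_Integration.integral_sum ZZ_int)
  \<comment> \<open>Only the diagonal of the double sum survives, with \<open>card I\<close> terms
    of size at most 1.\<close>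
  also have "\<dots> \<le> (\<Sum>c\<in>I. \<Sum>c'\<in>I. if c = c' then 1 else 0) / (card I)\<^sup>2"
    using orth diag by (intro divide_right_mono sum_mono) auto
  also have "\<dots> = 1 / card I"
    using I by (simp add: power2_eq_square)
  finally show "(\<integral>(x, y). ((\<Sum>c\<in>I. h (x c, y c)) / card I - \<mu>)\<^sup>2 \<partial>Q) \<le> 1 / card I" .
qed

section \<open>Concentration of distances on the torus\<close>

lemma circle_dist_sq_bounds:
  assumes "x \<in> {0..1}" "y \<in> {0..1}"
  shows "(circle_dist x y)\<^sup>2 \<in> {0..1}"
  using assms by (auto simp: circle_dist_def abs_square_le_1 abs_le_iff min_def abs_if)

lemma borel_measurable_circle_dist:
  assumes "sets \<pi> = sets (restrict_space borel {0..1})"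
  shows "(\<lambda>(x, y). circle_dist x y) \<in> borel_measurable (\<pi> \<Otimes>\<^sub>M \<pi>)"
proof -
  have [measurable]: "(\<lambda>x. x) \<in> borel_measurable \<pi>"
    using assms by (simp add: measurable_cong_sets[OF assms refl] measurable_restrict_space1)
  show ?thesis
    unfolding circle_dist_def by measurable
qed

lemma borel_measurable_torus_dist:
  assumes "sets \<pi> = sets (restrict_space borel {0..1})"
  shows "(\<lambda>(x, y). torus_dist d x y) \<in>
    borel_measurable ((\<Pi>\<^sub>M i\<in>{1..d}. \<pi>) \<Otimes>\<^sub>M (\<Pi>\<^sub>M i\<in>{1..d}. \<pi>))"
proof -
  note [measurable] = borel_measurable_circle_dist[OF assms]
  show ?thesis
    unfolding torus_dist_def by measurable
qed

text \<open>A Chebyshev argument in integrated form. Where the average squared distance is near its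
  mean, continuity makes the integrand small; elsewhere the integrand is at most 1, which is
  dominated by the squared deviation over \<open>\<delta>\<^sup>2\<close>.\<close>

lemma tendsto_integral_torus_dist:
  fixes q :: "real \<Rightarrow> real" and r0 :: "nat \<Rightarrow> real"
  assumes \<pi>: "prob_space \<pi>" and sets: "sets \<pi> = sets (restrict_space borel {0..1})"
    and q: "continuous_on UNIV q" and q01: "\<And>x. q x \<in> {0..1}"
    and k: "k > 0" and r0: "(\<lambda>d. r0 d / sqrt (real d)) \<longlonglongrightarrow> sqrt k"
  defines "P \<equiv> \<lambda>d. \<Pi>\<^sub>M i\<in>{1..d}. \<pi>"
  defines "l \<equiv> q (sqrt (mean_sq_circle_dist \<pi> / k))"
  shows "(\<lambda>d. \<integral>(x, y). \<bar>q (torus_dist d x y / r0 d) - l\<bar> \<partial>(P d \<Otimes>\<^sub>M P d)) \<longlonglongrightarrow> 0"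
proof (rule order_tendstoI)
  fix a :: real assume "a < 0"
  then show "\<forall>\<^sub>F d in sequentially. a < (\<integral>(x, y). \<bar>q (torus_dist d x y / r0 d) - l\<bar> \<partial>(P d \<Otimes>\<^sub>M P d))"
    by (intro always_eventually allI less_le_trans[OF _ Bochner_Integration.integral_nonneg]) auto
next
  fix a :: real assume "0 < a"
  define h where "h = (\<lambda>(x, y). (circle_dist x y)\<^sup>2)"
  define \<mu> where "\<mu> = (\<integral>z. h z \<partial>(\<pi> \<Otimes>\<^sub>M \<pi>))"
  have \<mu>: "\<mu> = mean_sq_circle_dist \<pi>"
    by (simp add: \<mu>_def h_def mean_sq_circle_dist_def)
  have space: "space \<pi> = {0..1}"
    using sets_eq_imp_space_eq[OF sets] by (simp add: space_restrict_space)
  \<comment> \<open>The random average of squared distances and the deterministic scaled radius are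
    treated as two variables, and continuity is used jointly in both. The function
    \<open>sqrt\<close> is continuous on the whole real line, so a full neighbourhood of
    \<open>\<mu>\<close> works even if \<open>\<mu>\<close> is 0.\<close>
  have "((\<lambda>z. q (sqrt (fst z) / snd z)) \<longlongrightarrow> q (sqrt \<mu> / sqrt k)) (nhds \<mu> \<times>\<^sub>F nhds (sqrt k))"
    using k q
    by (intro continuous_on_tendsto_compose[OF q] tendsto_divide tendsto_real_sqrt
        filterlim_fst filterlim_snd) auto
  then have "\<forall>\<^sub>F z in nhds \<mu> \<times>\<^sub>F nhds (sqrt k). dist (q (sqrt (fst z) / snd z)) l < a / 2"
    using \<open>0 < a\<close> tendstoD[of _ "q (sqrt \<mu> / sqrt k)" _ "a / 2"] by (simp add: l_def \<mu> real_sqrt_divide)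
  \<comment> \<open>The neighbourhood contains a rectangle: \<open>A\<close> will hold for the
    average outside a rare event, and \<open>B\<close> for the scaled radius once \<open>d\<close>
    is large.\<close>
  then obtain A B where A: "eventually A (nhds \<mu>)" and B: "eventually B (nhds (sqrt k))"
    and AB: "\<And>s t. A s \<Longrightarrow> B t \<Longrightarrow> \<bar>q (sqrt s / t) - l\<bar> < a / 2"
    unfolding eventually_prod_filter by (auto simp: dist_real_def)
  obtain \<delta> where \<delta>: "0 < \<delta>" "\<And>s. \<bar>s - \<mu>\<bar> < \<delta> \<Longrightarrow> A s"
    using A by (auto simp: eventually_nhds_metric dist_real_def)
  \<comment> \<open>This bounds the contribution of the points whose average is at least
    \<open>\<delta>\<close> away from \<open>\<mu>\<close>; the other half of \<open>a\<close> is
    reserved for continuity.\<close>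
  have "(\<lambda>d. 1 / real d / \<delta>\<^sup>2) \<longlonglongrightarrow> 0"
    by (intro tendsto_divide_zero lim_1_over_n)
  then have "\<forall>\<^sub>F d in sequentially. 1 / real d / \<delta>\<^sup>2 < a / 2"
    using \<open>0 < a\<close> by (intro order_tendstoD) auto
  moreover have "\<forall>\<^sub>F d in sequentially. B (r0 d / sqrt (real d))"
    using r0 B by (auto simp: filterlim_iff)
  ultimately show "\<forall>\<^sub>F d in sequentially. (\<integral>(x, y). \<bar>q (torus_dist d x y / r0 d) - l\<bar> \<partial>(P d \<Otimes>\<^sub>M P d)) < a"
    using eventually_gt_at_top[of "0 :: nat"]
  proof eventually_elim
    case (elim d)
    let ?Q = "P d \<Otimes>\<^sub>M P d"
    let ?dev = "\<lambda>(x, y). ((\<Sum>c\<in>{1..d}. h (x c, y c)) / card {1..d} - \<mu>)\<^sup>2"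
    interpret P: prob_space "P d" unfolding P_def by (intro prob_space_PiM \<pi>)
    interpret Q: pair_prob_space "P d" "P d" ..
    have h_meas: "h \<in> borel_measurable (\<pi> \<Otimes>\<^sub>M \<pi>)"
      using borel_measurable_power[OF borel_measurable_circle_dist[OF sets], of 2]
      by (simp add: h_def case_prod_beta)
    have h01: "h z \<in> {0..1}" if "z \<in> space (\<pi> \<Otimes>\<^sub>M \<pi>)" for z
      using that circle_dist_sq_bounds by (auto simp: h_def space_pair_measure space)
    have dev: "integrable ?Q ?dev" "(\<integral>z. ?dev z \<partial>?Q) \<le> 1 / real d"
      using second_moment_average_PiM_pair[OF \<pi> _ _ h_meas h01, of "{1..d}"] elim
      by (auto simp: \<mu>_def P_def)
    have q_meas: "q \<in> borel_measurable borel"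
      using q by (rule borel_measurable_continuous_onI)
    have "(\<lambda>z. \<bar>q ((case z of (x, y) \<Rightarrow> torus_dist d x y) / r0 d) - l\<bar>) \<in> borel_measurable ?Q"
      using borel_measurable_torus_dist[OF sets, of d] q_meas unfolding P_def by measurable
    then have meas: "(\<lambda>(x, y). \<bar>q (torus_dist d x y / r0 d) - l\<bar>) \<in> borel_measurable ?Q"
      by (simp add: case_prod_beta)
    have l_diff: "\<bar>q x - l\<bar> \<le> 1" for x
      using q01[of x] q01[of "sqrt (mean_sq_circle_dist \<pi> / k)"] by (auto simp: l_def)
    have pointwise: "(case z of (x, y) \<Rightarrow> \<bar>q (torus_dist d x y / r0 d) - l\<bar>) \<le> a / 2 + ?dev z / \<delta>\<^sup>2" for z
    proof (cases z)
      case (Pair x y)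
      let ?s = "(\<Sum>c\<in>{1..d}. h (x c, y c)) / card {1..d}"
      \<comment> \<open>Numerator and denominator are both divided by \<open>sqrt d\<close>, which
        brings in the average and the scaled radius.\<close>
      have s: "torus_dist d x y / r0 d = sqrt ?s / (r0 d / sqrt (real d))"
        using elim by (simp add: torus_dist_def h_def real_sqrt_divide)
      show ?thesis
      proof (cases "\<bar>?s - \<mu>\<bar> < \<delta>")
        case True
        then have "\<bar>q (torus_dist d x y / r0 d) - l\<bar> < a / 2"
          unfolding s using elim \<delta> by (intro AB) auto
        then show ?thesis
          by (auto simp: Pair intro!: add_increasing2)
      next
        case False
        then have "\<delta>\<^sup>2 \<le> \<bar>?s - \<mu>\<bar>\<^sup>2"
          using \<delta> by (intro power_mono) auto
        then have "1 \<le> ?dev z / \<delta>\<^sup>2"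
          using \<delta> by (simp add: Pair)
        then show ?thesis
          using l_diff[of "torus_dist d x y / r0 d"] \<open>0 < a\<close> by (simp add: Pair)
      qed
    qed
    have "(\<integral>(x, y). \<bar>q (torus_dist d x y / r0 d) - l\<bar> \<partial>?Q) \<le> (\<integral>z. a / 2 + ?dev z / \<delta>\<^sup>2 \<partial>?Q)"
    proof (rule integral_mono)
      show "integrable ?Q (\<lambda>(x, y). \<bar>q (torus_dist d x y / r0 d) - l\<bar>)"
        using meas l_diff by (intro Q.integrable_const_bound[where B = 1]) auto
      show "integrable ?Q (\<lambda>z. a / 2 + ?dev z / \<delta>\<^sup>2)"
        using dev(1) by (intro Bochner_Integration.integrable_add integrable_divide) auto
    qed (rule pointwise)
    also have "\<dots> = a / 2 + (\<integral>z. ?dev z \<partial>?Q) / \<delta>\<^sup>2"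
      using dev(1) by (subst Bochner_Integration.integral_add) (auto simp: Q.prob_space)
    also have "\<dots> \<le> a / 2 + 1 / real d / \<delta>\<^sup>2"
      using dev(2) by (intro add_left_mono divide_right_mono) auto
    also have "\<dots> < a"
      using elim by simp
    finally show ?case .
  qed
qed

section \<open>Comparison of a soft random geometric graph with an Erdos-Renyi graph\<close>

text \<open>The bound on graph probabilities for fixed positions is averaged over the positions.
  Each resulting term involves two nodes only, and every such pair of positions has the same joint
  law, so all terms are equal.\<close>

lemma measure_soft_rgg_diff:
  fixes \<rho> :: "'a \<Rightarrow> 'a \<Rightarrow> real"
  assumes M: "prob_space M"
    and \<rho>: "(\<lambda>(x, y). q (\<rho> x y / r)) \<in> borel_measurable (M \<Otimes>\<^sub>M M)"
    and q01: "\<And>x. q x \<in> {0..1}" and l: "l \<in> {0..1}"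
    and g: "g \<in> labelled_graphs n"
  shows "\<bar>measure (soft_rgg n M \<rho> q r) {g} - measure (erdos_renyi n l) {g}\<bar> \<le>
    real (card (node_pairs n)) * (\<integral>(x, y). \<bar>q (\<rho> x y / r) - l\<bar> \<partial>(M \<Otimes>\<^sub>M M))"
proof -
  define N where "N = (\<Pi>\<^sub>M i\<in>{1..n}. M)"
  define K where "K X = independent_edges n (\<lambda>i j. q (\<rho> (X i) (X j) / r))" for X
  define c where "c = pmf (independent_edges n (\<lambda>i j. l)) g"
  interpret N: prob_space N unfolding N_def by (intro prob_space_PiM M)
  have pair: "(\<lambda>X. (X i, X j)) \<in> measurable N (M \<Otimes>\<^sub>M M)"
      "distr N (M \<Otimes>\<^sub>M M) (\<lambda>X. (X i, X j)) = M \<Otimes>\<^sub>M M"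
    if "(i, j) \<in> node_pairs n" for i j
  proof -
    have ij: "i \<in> {1..n}" "j \<in> {1..n}" "i \<noteq> j"
      using that by (auto simp: node_pairs_def)
    then have [measurable]: "(\<lambda>X. X i) \<in> measurable N M" "(\<lambda>X. X j) \<in> measurable N M"
      by (auto simp: N_def intro: measurable_component_singleton)
    show "(\<lambda>X. (X i, X j)) \<in> measurable N (M \<Otimes>\<^sub>M M)"
      by measurable
    show "distr N (M \<Otimes>\<^sub>M M) (\<lambda>X. (X i, X j)) = M \<Otimes>\<^sub>M M"
      unfolding N_def using distr_PiM_pair[of "\<lambda>_. M", OF M ij] .
  qed
  have meas: "(\<lambda>X. q (\<rho> (X i) (X j) / r)) \<in> borel_measurable N" if "(i, j) \<in> node_pairs n" for i j
    using measurable_compose[OF pair(1)[OF that] \<rho>] by simp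
  have K: "(\<lambda>X. measure_pmf (K X)) \<in> measurable N (subprob_algebra (count_space UNIV))"
    unfolding K_def using q01 meas by (intro measurable_independent_edges) auto
  have pmf_int: "integrable N (\<lambda>X. pmf (K X) g)"
  proof (rule N.integrable_const_bound[where B = 1])
    have "(\<lambda>X. measure (measure_pmf (K X)) {g}) \<in> borel_measurable N"
      using K by (intro measurable_compose[OF K measurable_measure_subprob_algebra]) auto
    then show "(\<lambda>X. pmf (K X) g) \<in> borel_measurable N"
      by (simp add: pmf.rep_eq)
  qed (simp add: pmf_le_1)
  have edge_int: "integrable N (\<lambda>X. \<bar>q (\<rho> (X i) (X j) / r) - l\<bar>)" if "(i, j) \<in> node_pairs n" for i j
  proof (rule N.integrable_const_bound[where B = 1])
    have "\<bar>q x - l\<bar> \<le> 1" for x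
      using q01[of x] l by auto
    then show "AE X in N. norm \<bar>q (\<rho> (X i) (X j) / r) - l\<bar> \<le> 1"
      by simp
  qed (use meas[OF that] in measurable)
  \<comment> \<open>Evaluating the bind averages the conditional graph probability. The Erdos-Renyi
    value \<open>c\<close> is constant in the positions and can be moved under the same
    integral.\<close>
  have "measure (soft_rgg n M \<rho> q r) {g} = (\<integral>X. pmf (K X) g \<partial>N)"
    unfolding soft_rgg_def N_def[symmetric] K_def[symmetric]
    using K by (subst N.measure_bind) (auto simp: pmf.rep_eq)
  then have "\<bar>measure (soft_rgg n M \<rho> q r) {g} - measure (erdos_renyi n l) {g}\<bar> =
      \<bar>\<integral>X. pmf (K X) g - c \<partial>N\<bar>"
    using pmf_int by (simp add: erdos_renyi_def c_def pmf.rep_eq N.prob_space)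
  also have "\<dots> \<le> (\<integral>X. \<bar>pmf (K X) g - c\<bar> \<partial>N)"
    by (rule integral_abs_bound)
  also have "\<dots> \<le> (\<integral>X. (\<Sum>(i, j)\<in>node_pairs n. \<bar>q (\<rho> (X i) (X j) / r) - l\<bar>) \<partial>N)"
  proof (rule integral_mono)
    show "integrable N (\<lambda>X. \<bar>pmf (K X) g - c\<bar>)"
      using pmf_int by auto
    show "integrable N (\<lambda>X. \<Sum>(i, j)\<in>node_pairs n. \<bar>q (\<rho> (X i) (X j) / r) - l\<bar>)"
      using edge_int by (intro Bochner_Integration.integrable_sum) auto
    show "\<bar>pmf (K X) g - c\<bar> \<le> (\<Sum>(i, j)\<in>node_pairs n. \<bar>q (\<rho> (X i) (X j) / r) - l\<bar>)" for X
      unfolding K_def c_def using q01 l by (intro abs_pmf_independent_edges_diff g) auto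
  qed
  also have "\<dots> = (\<Sum>(i, j)\<in>node_pairs n. \<integral>X. \<bar>q (\<rho> (X i) (X j) / r) - l\<bar> \<partial>N)"
    using edge_int by (subst Bochner_Integration.integral_sum) (auto intro!: sum.cong)
  also have "\<dots> = (\<Sum>(i, j)\<in>node_pairs n. \<integral>(x, y). \<bar>q (\<rho> x y / r) - l\<bar> \<partial>(M \<Otimes>\<^sub>M M))"
  proof (intro sum.cong refl, clarify)
    fix i j assume ij: "(i, j) \<in> node_pairs n"
    have "(\<lambda>(x, y). \<bar>q (\<rho> x y / r) - l\<bar>) \<in> borel_measurable (M \<Otimes>\<^sub>M M)"
      using borel_measurable_abs[OF borel_measurable_diff[OF \<rho> borel_measurable_const[of l]]]
      by (simp add: case_prod_beta)
    then show "(\<integral>X. \<bar>q (\<rho> (X i) (X j) / r) - l\<bar> \<partial>N) =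
        (\<integral>(x, y). \<bar>q (\<rho> x y / r) - l\<bar> \<partial>(M \<Otimes>\<^sub>M M))"
      by (subst pair(2)[OF ij, symmetric], subst integral_distr[OF pair(1)[OF ij]]) auto
  qed
  also have "\<dots> = real (card (node_pairs n)) * (\<integral>(x, y). \<bar>q (\<rho> x y / r) - l\<bar> \<partial>(M \<Otimes>\<^sub>M M))"
    by simp
  finally show ?thesis .
qed

section \<open>The high-dimensional limit of the torus ensembles\<close>

theorem theorem3:
  fixes n :: nat
    and \<pi> :: "real measure"
    and p :: "real \<Rightarrow> real"
    and r0 :: "nat \<Rightarrow> real"
    and k :: real
  assumes "prob_space \<pi>"
    and "sets \<pi> = sets (restrict_space borel {0..1})"
    and "connection_function p"
    and "continuous_on {0..} p"
    and "k > 0"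
    and "(\<lambda>d. r0 d - sqrt (k * real d)) \<in> o(\<lambda>d. sqrt (real d))"
  shows "ensembles_converge n (\<lambda>d. torus_soft_rgg n \<pi> p d (r0 d))
           (erdos_renyi n (p (sqrt (mean_sq_circle_dist \<pi> / k))))"
proof -
  \<comment> \<open>p is arbitrary, possibly not even measurable, on the negative reals. This matters only for
    the finitely many d for which r0 d is not positive.\<close>
  define q where "q x = p (max 0 x)" for x
  define l where "l = p (sqrt (mean_sq_circle_dist \<pi> / k))"
  \<comment> \<open>Nonnegativity puts the argument of the limiting edge probability in the range
    where \<open>q\<close> agrees with \<open>p\<close>.\<close>
  have "0 \<le> mean_sq_circle_dist \<pi>"
    unfolding mean_sq_circle_dist_def by (intro Bochner_Integration.integral_nonneg) auto
  then have l: "l = q (sqrt (mean_sq_circle_dist \<pi> / k))"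
    using \<open>k > 0\<close> by (simp add: l_def q_def)
  have q01: "q x \<in> {0..1}" for x
    using assms(3) unfolding connection_function_def q_def by (blast intro: max.cobounded1)
  have q: "continuous_on UNIV q"
    unfolding q_def by (intro continuous_on_compose2[OF assms(4)] continuous_intros) auto
  have "(\<lambda>d. (r0 d - sqrt (k * real d)) / sqrt (real d) + sqrt k) \<longlonglongrightarrow> 0 + sqrt k"
    by (intro tendsto_add tendsto_const smalloD_tendsto assms(6))
  \<comment> \<open>For \<open>d = 0\<close> the division by zero would leave \<open>sqrt k\<close>
    on the left and 0 on the right.\<close>
  moreover have "\<forall>\<^sub>F d in sequentially.
      (r0 d - sqrt (k * real d)) / sqrt (real d) + sqrt k = r0 d / sqrt (real d)"
    using eventually_gt_at_top[of "0 :: nat"]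
    by eventually_elim (simp add: real_sqrt_mult field_simps)
  ultimately have lim: "(\<lambda>d. r0 d / sqrt (real d)) \<longlonglongrightarrow> sqrt k"
    by (auto dest: Lim_transform_eventually)
  have pos: "\<forall>\<^sub>F d in sequentially. 0 < r0 d"
    using order_tendstoD(1)[OF lim, of 0] \<open>k > 0\<close>
    by (auto elim: eventually_mono simp: zero_less_divide_iff)
  define P where "P d = (\<Pi>\<^sub>M i\<in>{1..d}. \<pi>)" for d :: nat
  define dev where "dev d = (\<integral>(x, y). \<bar>q (torus_dist d x y / r0 d) - l\<bar> \<partial>(P d \<Otimes>\<^sub>M P d))" for d
  have dev: "dev \<longlonglongrightarrow> 0"
    using tendsto_integral_torus_dist[OF assms(1,2) q q01 assms(5) lim]
    by (simp add: dev_def[abs_def] P_def l)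
  show ?thesis
    unfolding ensembles_converge_def
  proof
    fix g assume g: "g \<in> labelled_graphs n"
    have "\<forall>\<^sub>F d in sequentially.
        norm (measure (torus_soft_rgg n \<pi> p d (r0 d)) {g} - measure (erdos_renyi n l) {g}) \<le>
          real (card (node_pairs n)) * dev d"
      using pos
    proof eventually_elim
      case (elim d)
      \<comment> \<open>With a positive radius only nonnegative arguments occur, so \<open>p\<close>
        and \<open>q\<close> give exactly the same ensemble.\<close>
      have "torus_dist d x y / r0 d \<ge> 0" for x y
        using elim by (simp add: torus_dist_def sum_nonneg)
      then have eq: "torus_soft_rgg n \<pi> p d (r0 d) = soft_rgg n (P d) (torus_dist d) q (r0 d)"
        by (simp add: torus_soft_rgg_def soft_rgg_def q_def P_def)
      have q_meas: "q \<in> borel_measurable borel"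
        using q by (rule borel_measurable_continuous_onI)
      have "(\<lambda>z. q ((case z of (x, y) \<Rightarrow> torus_dist d x y) / r0 d)) \<in> borel_measurable (P d \<Otimes>\<^sub>M P d)"
        using borel_measurable_torus_dist[OF assms(2), of d] q_meas unfolding P_def by measurable
      then have "(\<lambda>(x, y). q (torus_dist d x y / r0 d)) \<in> borel_measurable (P d \<Otimes>\<^sub>M P d)"
        by (simp add: case_prod_beta)
      moreover have "prob_space (P d)"
        unfolding P_def by (intro prob_space_PiM assms(1))
      ultimately show ?case
        unfolding eq dev_def real_norm_def
        using q01 g by (intro measure_soft_rgg_diff) (auto simp: l)
    qed
    \<comment> \<open>Since \<open>n\<close> is fixed, the number of node pairs is a constant
      factor.\<close>
    moreover have "(\<lambda>d. real (card (node_pairs n)) * dev d) \<longlonglongrightarrow> 0"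
      using dev by (rule tendsto_mult_right_zero)
    ultimately have "(\<lambda>d. measure (torus_soft_rgg n \<pi> p d (r0 d)) {g} - measure (erdos_renyi n l) {g}) \<longlonglongrightarrow> 0"
      by (rule Lim_null_comparison)
    then show "(\<lambda>d. measure (torus_soft_rgg n \<pi> p d (r0 d)) {g}) \<longlonglongrightarrow>
        measure (erdos_renyi n (p (sqrt (mean_sq_circle_dist \<pi> / k)))) {g}"
      by (simp add: l_def LIM_zero_iff)
  qed
qed

end
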